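(* Consider an instance of the two-dimensional irregular bin packing problem with convex polygons and fixed orientations, and run on it the combinatorial Benders / branch-and-price algorithm described in the context. If the algorithm terminates with a solution, then the returned solution is an optimal solution of the original two-dimensional irregular bin packing problem, i.e. it is a feasible packing of all items using the minimum possible number of bins.
   Context: **Problem.** $I=\{1,\dots,n\}$ is a finite set of items, each a convex polygon in the plane that may be translated but not rotated; item $i$ has area $A_i$. Bins are identical $W\times H$ rectangles of area $A=WH$, and $n$ bins are available. The items must be partitioned among bins so that in each bin the assigned items can be translated to lie inside the bin with no two overlapping (pairwise disjoint interiors); the number of used bins is minimized. For $S\subseteq I$, $\Phi(S)=1$ if the items of $S$ can be packed into one bin in this sense, and $\Phi(S)=0$ otherwise; $\mathcal F=\{S\subseteq I:\Phi(S)=0\}$. The exact single-bin oracle correctly computes $\Phi(S)$ (and supplies a placement when $\Phi(S)=1$). **Restricted Benders master problem (RBMP).** $\mathcal P$ is the set of all patterns, i.e. item subsets satisfying the area condition; for $p\in\mathcal P$, $S(p)\subseteq I$ is its item set, so $\sum_{i\in S(p)}A_i\le A$, and $a_{ip}=1$ if $i\in S(p)$, $0$ otherwise. For a cut pool $\mathcal F'\subseteq\mathcal F$, RBMP$(\mathcal F')$ is: minimize $\sum_{p\in\mathcal P}\lambda_p$ subject to $\sum_{p}a_{ip}\lambda_p=1$ for all $i\in I$; $\sum_{p\in\mathcal P:S\subseteq S(p)}\lambda_p=0$ for all $S\in\mathcal F'$; $\lambda_p\in\{0,1\}$. **Branch-and-price at objective layer $k$ under cut pool $\mathcal F'$.**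 A node is given by a set of pairs of items required to be together and a set of pairs required to be separate. Its admissible columns are the patterns containing no member of $\mathcal F'$, containing both or neither item of every "together" pair, and not both items of any "separate" pair. At a node, the linear relaxation (minimize $\sum\lambda_p$ subject to the covering equalities and $\lambda\ge 0$, over admissible columns) is solved by column generation: a restricted problem over a subset $\mathcal P'$ of the admissible columns is solved, with optimal value $z^*_{RMP}$ and covering duals $\pi$, and an exact pricing procedure finds the minimum reduced cost $c^*$ of $1-\sum_{i\in S(p)}\pi_i$ over admissible columns not in $\mathcal P'$; if $c^*<0$ a minimizing column is added and the process repeats, otherwise the node relaxation is solved. A node is fathomed if it is infeasible, if a lower bound on it exceeds $k$ (in particular if $c^*<0$ and $z^*_{RMP}>k(1-c^* )$), or if all its integer solutions have been explored and rejected. If the node relaxation has an integer optimal solution with value $k$, it is an integer RBMP solution found. If it is fractional and not fathomed, one selects a pair $(i,j)$ whose co-assignment value $\rho_{ij}=\sum_{p\in\mathcal P':\,i,j\in S(p)}\lambda_p$ is fractional (the one closest to $\tau=0.55$), and creates two children: $i,j$ together, and $i,j$ separate. **Algorithm.** 1. Initialize $\mathcal F'$ with all pairs $\{i,j\}$, $i\neq j$, having $\Phi(\{i,j\})=0$. Solve the initial RBMP to obtain the optimal value $z^0_{RBMP}$ and the valid initial lower bound $LB_0=\lceil z^0_{RBMP}-\varepsilon\rceil$ ($\varepsilon$ a small numerical tolerance). Set $k=LB_0$. 2. Search RBMP$(\mathcal F')$ by the branch-and-price procedure above for an integer solution with objective value $k$. If it is certified that none exists, set $k\leftarrow k+1$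 and repeat step 2. 3. Otherwise call the exact oracle on the item sets $S_b$ of the selected bins, stopping early only once $\max\{\lfloor m/2\rfloor,1\}$ infeasible ones have been found, where $m$ is the number of selected bins. If all are certified feasible, return this solution (with the placements) and stop. 4. Otherwise, for each infeasible $S_b$ detected, add to $\mathcal F'$ a subset $\bar S_b\subseteq S_b$ with $\Phi(\bar S_b)=0$ certified by the oracle ($\bar S_b=S_b$, or, if $|S_b|<8$, a set obtained from $S_b$ by successively deleting items while infeasibility remains certified). Discard columns containing a newly added set, enforce the new cuts in pricing, and continue the branch-and-price search at the same layer $k$ from the recorded state: previously fathomed nodes are not revisited, and the remaining nodes are processed with the enlarged cut pool. Return to step 2. *)

theory Defs
  imports "HOL-Analysis.Analysis" "HOL-Library.Disjoint_Sets"
begin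

section \<open>The packing problem\<close>

type_synonym point = "real \<times> real"

record bpp =
  num :: nat
  shape :: "nat \<Rightarrow> point set"
  width :: real
  height :: real

definition items :: "bpp \<Rightarrow> nat set" where
  "items X = {1..num X}"

definition bin :: "bpp \<Rightarrow> point set" where
  "bin X = cbox (0, 0) (width X, height X)"

definition bin_area :: "bpp \<Rightarrow> real" where
  "bin_area X = width X * height X"

definition item_area :: "bpp \<Rightarrow> nat \<Rightarrow> real" where
  "item_area X i = measure lebesgue (shape X i)"

definition convex_polygon :: "point set \<Rightarrow> bool" where
  "convex_polygon P \<longleftrightarrow> polytope P \<and> interior P \<noteq> {}"

definition valid_instance :: "bpp \<Rightarrow> bool" where
  "valid_instance X \<longleftrightarrow>
     width X > 0 \<and> height X > 0 \<and> (\<forall>i\<in>items X. convex_polygon (shape X i))"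

type_synonym placement = "nat \<Rightarrow> point"

definition placed :: "bpp \<Rightarrow> placement \<Rightarrow> nat \<Rightarrow> point set" where
  "placed X t i = (\<lambda>x. t i + x) ` shape X i"

definition packs :: "bpp \<Rightarrow> nat set \<Rightarrow> placement \<Rightarrow> bool" where
  "packs X S t \<longleftrightarrow>
     (\<forall>i\<in>S. placed X t i \<subseteq> bin X) \<and>
     (\<forall>i\<in>S. \<forall>j\<in>S. i \<noteq> j \<longrightarrow> interior (placed X t i) \<inter> interior (placed X t j) = {})"

text \<open>The predicate \<open>packable X S\<close> is \<open>\<Phi>(S) = 1\<close>.\<close>

definition packable :: "bpp \<Rightarrow> nat set \<Rightarrow> bool" where
  "packable X S \<longleftrightarrow> (\<exists>t. packs X S t)"

text \<open>Bins are identical, so a solution is given by the item sets of its used bins,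
  together with a placement for each of them.  Blocks of a partition are nonempty.\<close>

definition feasible_packing :: "bpp \<Rightarrow> nat set set \<Rightarrow> (nat set \<Rightarrow> placement) \<Rightarrow> bool" where
  "feasible_packing X B pl \<longleftrightarrow>
     partition_on (items X) B \<and> card B \<le> num X \<and> (\<forall>S\<in>B. packs X S (pl S))"

definition optimal_packing :: "bpp \<Rightarrow> nat set set \<Rightarrow> (nat set \<Rightarrow> placement) \<Rightarrow> bool" where
  "optimal_packing X B pl \<longleftrightarrow>
     feasible_packing X B pl \<and>
     (\<forall>B' pl'. feasible_packing X B' pl' \<longrightarrow> card B \<le> card B')"

type_synonym oracle_fun = "nat set \<Rightarrow> placement option"

definition exact_oracle :: "bpp \<Rightarrow> oracle_fun \<Rightarrow> bool" where
  "exact_oracle X orc \<longleftrightarrow>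
     (\<forall>S. S \<subseteq> items X \<longrightarrow>
        (case orc S of Some t \<Rightarrow> packs X S t | None \<Rightarrow> \<not> packable X S))"


section \<open>The restricted Benders master problem\<close>

text \<open>A pattern \<open>p\<close> is identified with its item set \<open>S(p)\<close>.  Column weights vanish outside
  the column set under consideration.\<close>

type_synonym weights = "nat set \<Rightarrow> real"

definition patterns :: "bpp \<Rightarrow> nat set set" where
  "patterns X = {p. p \<subseteq> items X \<and> (\<Sum>i\<in>p. item_area X i) \<le> bin_area X}"

definition contains_cut :: "nat set set \<Rightarrow> nat set \<Rightarrow> bool" where
  "contains_cut F p \<longleftrightarrow> (\<exists>S\<in>F. S \<subseteq> p)"

definition rbmp_feasible :: "bpp \<Rightarrow> nat set set \<Rightarrow> weights \<Rightarrow> bool" where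
  "rbmp_feasible X F l \<longleftrightarrow>
     (\<forall>p\<in>patterns X. l p \<in> {0, 1}) \<and> (\<forall>p. p \<notin> patterns X \<longrightarrow> l p = 0) \<and>
     (\<forall>i\<in>items X. (\<Sum>p | p \<in> patterns X \<and> i \<in> p. l p) = 1) \<and>
     (\<forall>S\<in>F. (\<Sum>p | p \<in> patterns X \<and> S \<subseteq> p. l p) = 0)"

definition objective :: "bpp \<Rightarrow> weights \<Rightarrow> real" where
  "objective X l = (\<Sum>p\<in>patterns X. l p)"

definition rbmp_opt_value :: "bpp \<Rightarrow> nat set set \<Rightarrow> real \<Rightarrow> bool" where
  "rbmp_opt_value X F z \<longleftrightarrow>
     (\<exists>l. rbmp_feasible X F l \<and> objective X l = z) \<and>
     (\<forall>l. rbmp_feasible X F l \<longrightarrow> z \<le> objective X l)"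


section \<open>Nodes, linear relaxations and pricing\<close>

text \<open>A node consists of its ``together'' pairs and its ``separate'' pairs.\<close>

type_synonym node = "(nat \<times> nat) set \<times> (nat \<times> nat) set"

definition root :: node where
  "root = ({}, {})"

definition admissible :: "bpp \<Rightarrow> nat set set \<Rightarrow> node \<Rightarrow> nat set set" where
  "admissible X F nd =
     {p \<in> patterns X. \<not> contains_cut F p \<and>
        (\<forall>(i, j)\<in>fst nd. i \<in> p \<longleftrightarrow> j \<in> p) \<and>
        (\<forall>(i, j)\<in>snd nd. \<not> (i \<in> p \<and> j \<in> p))}"

definition node_int_solution :: "bpp \<Rightarrow> nat set set \<Rightarrow> node \<Rightarrow> weights \<Rightarrow> bool" where
  "node_int_solution X F nd l \<longleftrightarrow>
     rbmp_feasible X F l \<and> (\<forall>p. p \<notin> admissible X F nd \<longrightarrow> l p = 0)"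

definition lp_feasible :: "bpp \<Rightarrow> nat set set \<Rightarrow> weights \<Rightarrow> bool" where
  "lp_feasible X C l \<longleftrightarrow>
     (\<forall>p\<in>C. l p \<ge> 0) \<and> (\<forall>p. p \<notin> C \<longrightarrow> l p = 0) \<and>
     (\<forall>i\<in>items X. (\<Sum>p | p \<in> C \<and> i \<in> p. l p) = 1)"

definition lp_optimal :: "bpp \<Rightarrow> nat set set \<Rightarrow> weights \<Rightarrow> bool" where
  "lp_optimal X C l \<longleftrightarrow>
     lp_feasible X C l \<and> (\<forall>l'. lp_feasible X C l' \<longrightarrow> sum l C \<le> sum l' C)"

definition dual_feasible :: "nat set set \<Rightarrow> (nat \<Rightarrow> real) \<Rightarrow> bool" where
  "dual_feasible C y \<longleftrightarrow> (\<forall>p\<in>C. (\<Sum>i\<in>p. y i) \<le> 1)"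

definition dual_optimal :: "bpp \<Rightarrow> nat set set \<Rightarrow> (nat \<Rightarrow> real) \<Rightarrow> bool" where
  "dual_optimal X C y \<longleftrightarrow>
     dual_feasible C y \<and>
     (\<forall>y'. dual_feasible C y' \<longrightarrow> sum y' (items X) \<le> sum y (items X))"

definition rmp_solution ::
    "bpp \<Rightarrow> nat set set \<Rightarrow> weights \<Rightarrow> real \<Rightarrow> (nat \<Rightarrow> real) \<Rightarrow> bool" where
  "rmp_solution X C l z y \<longleftrightarrow> lp_optimal X C l \<and> z = sum l C \<and> dual_optimal X C y"

definition reduced_cost :: "(nat \<Rightarrow> real) \<Rightarrow> nat set \<Rightarrow> real" where
  "reduced_cost y p = 1 - (\<Sum>i\<in>p. y i)"

text \<open>\<open>p\<close> is a column of minimum reduced cost \<open>c\<close> among the admissible columns outside \<open>C\<close>.\<close>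

definition priced ::
    "bpp \<Rightarrow> nat set set \<Rightarrow> node \<Rightarrow> nat set set \<Rightarrow> (nat \<Rightarrow> real) \<Rightarrow> nat set \<Rightarrow> real \<Rightarrow> bool" where
  "priced X F nd C y p c \<longleftrightarrow>
     p \<in> admissible X F nd - C \<and> c = reduced_cost y p \<and>
     (\<forall>q\<in>admissible X F nd - C. c \<le> reduced_cost y q)"

text \<open>Column generation stops when the minimum reduced cost is nonnegative; this includes the
  case in which every admissible column is already present.\<close>

definition relaxation_solved ::
    "bpp \<Rightarrow> nat set set \<Rightarrow> node \<Rightarrow> nat set set \<Rightarrow> weights \<Rightarrow> real \<Rightarrow> bool" where
  "relaxation_solved X F nd C l z \<longleftrightarrow>
     (\<exists>y. rmp_solution X C l z y \<and>
        (admissible X F nd - C = {} \<or> (\<exists>p c. priced X F nd C y p c \<and> c \<ge> 0)))"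

definition integral_weights :: "nat set set \<Rightarrow> weights \<Rightarrow> bool" where
  "integral_weights C l \<longleftrightarrow> (\<forall>p\<in>C. l p \<in> {0, 1})"

definition coassign :: "nat set set \<Rightarrow> weights \<Rightarrow> nat \<Rightarrow> nat \<Rightarrow> real" where
  "coassign C l i j = (\<Sum>p | p \<in> C \<and> i \<in> p \<and> j \<in> p. l p)"

definition fractional_pair :: "bpp \<Rightarrow> nat set set \<Rightarrow> weights \<Rightarrow> nat \<Rightarrow> nat \<Rightarrow> bool" where
  "fractional_pair X C l i j \<longleftrightarrow>
     i \<in> items X \<and> j \<in> items X \<and> i \<noteq> j \<and> coassign C l i j \<notin> \<int>"

definition branching_pair :: "bpp \<Rightarrow> nat set set \<Rightarrow> weights \<Rightarrow> nat \<Rightarrow> nat \<Rightarrow> bool" where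
  "branching_pair X C l i j \<longleftrightarrow>
     fractional_pair X C l i j \<and>
     (\<forall>i' j'. fractional_pair X C l i' j' \<longrightarrow>
        \<bar>coassign C l i j - 0.55\<bar> \<le> \<bar>coassign C l i' j' - 0.55\<bar>)"


section \<open>The algorithm\<close>

definition selected :: "weights \<Rightarrow> nat set set" where
  "selected l = {p. l p = 1}"

definition detected :: "oracle_fun \<Rightarrow> nat set set \<Rightarrow> nat set set" where
  "detected orc D = {S \<in> D. orc S = None}"

definition detection_limit :: "weights \<Rightarrow> nat" where
  "detection_limit l = max (card (selected l) div 2) 1"

definition delete_item :: "oracle_fun \<Rightarrow> nat set \<Rightarrow> nat set \<Rightarrow> bool" where
  "delete_item orc S T \<longleftrightarrow> (\<exists>i\<in>S. T = S - {i} \<and> orc T = None)"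

definition cut_from :: "oracle_fun \<Rightarrow> nat set \<Rightarrow> nat set \<Rightarrow> bool" where
  "cut_from orc S T \<longleftrightarrow> T = S \<or> card S < 8 \<and> (delete_item orc)\<^sup>*\<^sup>* S T"

text \<open>An open (not yet fathomed and not yet branched) node is stored with its current
  restricted column set.\<close>

type_synonym open_nodes = "(node \<times> nat set set) set"

definition discard :: "nat set set \<Rightarrow> open_nodes \<Rightarrow> open_nodes" where
  "discard N Q = (\<lambda>(nd, C). (nd, {p \<in> C. \<not> contains_cut N p})) ` Q"

text \<open>\<open>Search F k Q R\<close>: branch-and-price at layer \<open>k\<close> with cut pool \<open>F\<close>, open nodes \<open>Q\<close> and
  rejected integer solutions \<open>R\<close>.  \<open>Check F k Q R l D\<close>: the integer solution \<open>l\<close> is being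
  checked, and the oracle has been called on the bins in \<open>D\<close>.  \<open>Done B pl\<close>: termination with
  a returned solution.\<close>

datatype state =
    Search "nat set set" int open_nodes "weights set"
  | Check "nat set set" int open_nodes "weights set" weights "nat set set"
  | Done "nat set set" "nat set \<Rightarrow> placement"

definition initial_pool :: "bpp \<Rightarrow> nat set set" where
  "initial_pool X = {{i, j} | i j. i \<in> items X \<and> j \<in> items X \<and> i \<noteq> j \<and> \<not> packable X {i, j}}"

definition initial_state :: "bpp \<Rightarrow> real \<Rightarrow> state \<Rightarrow> bool" where
  "initial_state X eps s \<longleftrightarrow>
     (\<exists>z C. rbmp_opt_value X (initial_pool X) z \<and>
        C \<subseteq> admissible X (initial_pool X) root \<and>
        s = Search (initial_pool X) \<lceil>z - eps\<rceil> {(root, C)} {})"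

text \<open>Choices the algorithm leaves open (node order, restricted column sets, order of oracle
  calls, ties) are nondeterministic.  Each layer starts with a fresh tree, since nodes are
  fathomed relative to the current layer.  The node in which an integer solution is found stays
  open and is processed again if the solution is rejected.\<close>

inductive step :: "bpp \<Rightarrow> oracle_fun \<Rightarrow> state \<Rightarrow> state \<Rightarrow> bool"
  for X :: bpp and orc :: oracle_fun where
  extend_columns:
    "\<lbrakk>(nd, C) \<in> Q; C \<subseteq> C'; C' \<subseteq> admissible X F nd\<rbrakk>
     \<Longrightarrow> step X orc (Search F k Q R) (Search F k (insert (nd, C') (Q - {(nd, C)})) R)"
| generate_column:
    "\<lbrakk>(nd, C) \<in> Q; rmp_solution X C l z y; priced X F nd C y p c; c < 0\<rbrakk>
     \<Longrightarrow> step X orc (Search F k Q R) (Search F k (insert (nd, insert p C) (Q - {(nd, C)})) R)"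
| fathom_infeasible:
    "\<lbrakk>(nd, C) \<in> Q; \<not> (\<exists>l. lp_feasible X (admissible X F nd) l)\<rbrakk>
     \<Longrightarrow> step X orc (Search F k Q R) (Search F k (Q - {(nd, C)}) R)"
| fathom_bound:
    "\<lbrakk>(nd, C) \<in> Q; \<forall>l. node_int_solution X F nd l \<longrightarrow> L \<le> objective X l; L > real_of_int k\<rbrakk>
     \<Longrightarrow> step X orc (Search F k Q R) (Search F k (Q - {(nd, C)}) R)"
| fathom_relaxation:
    "\<lbrakk>(nd, C) \<in> Q; relaxation_solved X F nd C l z; z > real_of_int k\<rbrakk>
     \<Longrightarrow> step X orc (Search F k Q R) (Search F k (Q - {(nd, C)}) R)"
| fathom_pricing:
    "\<lbrakk>(nd, C) \<in> Q; rmp_solution X C l z y; priced X F nd C y p c; c < 0;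
      z > real_of_int k * (1 - c)\<rbrakk>
     \<Longrightarrow> step X orc (Search F k Q R) (Search F k (Q - {(nd, C)}) R)"
| fathom_rejected:
    "\<lbrakk>(nd, C) \<in> Q;
      \<forall>l. node_int_solution X F nd l \<and> objective X l = real_of_int k \<longrightarrow> l \<in> R\<rbrakk>
     \<Longrightarrow> step X orc (Search F k Q R) (Search F k (Q - {(nd, C)}) R)"
| branch:
    "\<lbrakk>(nd, C) \<in> Q; relaxation_solved X F nd C l z; \<not> integral_weights C l; z \<le> real_of_int k;
      branching_pair X C l i j;
      together = (insert (i, j) (fst nd), snd nd); separate = (fst nd, insert (i, j) (snd nd));
      C1 \<subseteq> admissible X F together; C2 \<subseteq> admissible X F separate\<rbrakk>
     \<Longrightarrow> step X orc (Search F k Q R)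
           (Search F k ({(together, C1), (separate, C2)} \<union> (Q - {(nd, C)})) R)"
| next_layer:
    "C \<subseteq> admissible X F root
     \<Longrightarrow> step X orc (Search F k {} R) (Search F (k + 1) {(root, C)} R)"
| integer_solution:
    "\<lbrakk>(nd, C) \<in> Q; relaxation_solved X F nd C l z; integral_weights C l; z = real_of_int k\<rbrakk>
     \<Longrightarrow> step X orc (Search F k Q R) (Check F k Q R l {})"
| call_oracle:
    "\<lbrakk>S \<in> selected l - D; card (detected orc D) < detection_limit l\<rbrakk>
     \<Longrightarrow> step X orc (Check F k Q R l D) (Check F k Q R l (insert S D))"
| accept:
    "\<lbrakk>D = selected l; detected orc D = {}\<rbrakk>
     \<Longrightarrow> step X orc (Check F k Q R l D) (Done (selected l) (\<lambda>S. the (orc S)))"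
| reject:
    "\<lbrakk>D = selected l \<or> card (detected orc D) = detection_limit l; detected orc D \<noteq> {};
      \<forall>S\<in>detected orc D. cut_from orc S (g S); N = g ` detected orc D\<rbrakk>
     \<Longrightarrow> step X orc (Check F k Q R l D) (Search (F \<union> N) k (discard N Q) (insert l R))"

definition terminates_with ::
    "bpp \<Rightarrow> oracle_fun \<Rightarrow> real \<Rightarrow> nat set set \<Rightarrow> (nat set \<Rightarrow> placement) \<Rightarrow> bool" where
  "terminates_with X orc eps B pl \<longleftrightarrow>
     (\<exists>s. initial_state X eps s \<and> (step X orc)\<^sup>*\<^sup>* s (Done B pl))"

end

theory Submission
  imports Defs
begin

text \<open>Why a returned packing is optimal.  Let a packing partition be a partition of the items into
  packable blocks.  Its indicator function is a solution of the master problem, whatever the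
  current cut pool: a packable block satisfies the area condition, and it cannot contain a
  cut, because subsets of packable sets are packable whereas cuts are unpackable.
  The search therefore
  never loses a true packing, which is the content of \<open>search_invariant\<close>: no packing partition has
  fewer than \<open>k\<close> blocks, and each one with exactly \<open>k\<close> blocks consists of admissible columns of
  some open node.  When no node is open, there is none with \<open>k\<close> blocks either, so moving to
  \<open>k + 1\<close> is justified.  When a candidate with \<open>k\<close> bins passes the oracle, it is a packing, and by
  the invariant none is smaller.

  The delicate steps are those that fathom a node after column generation.
  They compare \<open>k\<close> with the optimal value \<open>z\<close> of a restricted linear program, whereas the
  duals only give
  upper bounds on their own sum: if \<open>y\<close> gives every block of a packing partition weight at most
  \<open>b\<close>, then the total of \<open>y\<close> is at most \<open>b\<close> times the number of blocks (\<open>dual_bound_packing\<close>).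
  Here \<open>b\<close> is 1 when the relaxation is solved and \<open>1 - c\<close> when the minimum reduced cost is \<open>c < 0\<close>.
  The link is \<open>z \<le> sum y (items X)\<close>, that is, strong duality (\<open>strong_duality\<close>), obtained from the
  Farkas lemma (\<open>farkas\<close>).\<close>

section \<open>Linear programming duality\<close>

text \<open>Bartl's induction on the number of functionals.  If the functionals
  in \<open>P\<close> alone do not force \<open>c \<le> 0\<close>, a vector \<open>x0\<close> witnesses this,
  and the hypothesis makes \<open>a q\<close> positive at it.  Projecting along \<open>x0\<close> onto the kernel of \<open>a q\<close>
  removes \<open>a q\<close> from the problem; the induction hypothesis expresses the projected \<open>c\<close>, and the
  coefficient that \<open>a q\<close> then gets in \<open>c\<close> is nonnegative by the choice of \<open>x0\<close>.\<close>

lemma farkas: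
  fixes a :: "'p \<Rightarrow> 'i \<Rightarrow> real" and c :: "'i \<Rightarrow> real"
  assumes "finite P" and "finite I"
    and "\<And>x. (\<And>p. p \<in> P \<Longrightarrow> (\<Sum>i\<in>I. a p i * x i) \<le> 0) \<Longrightarrow> (\<Sum>i\<in>I. c i * x i) \<le> 0"
  shows "\<exists>l. (\<forall>p\<in>P. 0 \<le> l p) \<and> (\<forall>i\<in>I. c i = (\<Sum>p\<in>P. l p * a p i))"
  using assms(1,3)
proof (induction P arbitrary: a c rule: finite_induct)
  case empty
  have "(\<Sum>i\<in>I. c i * c i) = 0"
    using empty[of c] by (intro antisym sum_nonneg) auto
  then have "\<forall>i\<in>I. c i * c i = 0"
    using sum_nonneg_eq_0_iff[OF assms(2), of "\<lambda>i. c i * c i"] by auto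
  then show ?case by auto
next
  case (insert q P)
  let ?val = "\<lambda>f x. \<Sum>i\<in>I. f i * x i"
  show ?case
  proof (cases "\<forall>x. (\<forall>p\<in>P. ?val (a p) x \<le> 0) \<longrightarrow> ?val c x \<le> 0")
    case True
    then obtain l where l: "\<forall>p\<in>P. 0 \<le> l p" "\<forall>i\<in>I. c i = (\<Sum>p\<in>P. l p * a p i)"
      using insert.IH[of a c] by blast
    have "(\<Sum>p\<in>P. (l(q := 0)) p * a p i) = (\<Sum>p\<in>P. l p * a p i)" for i
      using insert.hyps by (intro sum.cong) auto
    then show ?thesis
      using l insert.hyps by (intro exI[of _ "l(q := 0)"]) auto
  next
    case False
    then obtain x1 where x1: "\<And>p. p \<in> P \<Longrightarrow> ?val (a p) x1 \<le> 0" "?val c x1 > 0"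
      by force
    define s where "s = ?val (a q) x1"
    have s: "s > 0"
      using insert.prems[of x1] x1 unfolding s_def by force
    define x0 where "x0 = (\<lambda>i. x1 i / s)"
    have val_x0: "?val f x0 = ?val f x1 / s" for f
      by (simp add: x0_def sum_divide_distrib)
    have x0: "\<And>p. p \<in> P \<Longrightarrow> ?val (a p) x0 \<le> 0" "?val c x0 > 0" "?val (a q) x0 = 1"
      using x1 s by (auto simp: val_x0 divide_nonpos_pos s_def)
    define a' where "a' = (\<lambda>p i. a p i - ?val (a p) x0 * a q i)"
    define c' where "c' = (\<lambda>i. c i - ?val c x0 * a q i)"
    \<comment> \<open>The modified functionals are the original ones precomposed with the projection along
        \<open>x0\<close> onto the kernel of \<open>a q\<close>.\<close>
    have project: "?val (\<lambda>i. f i - ?val f x0 * a q i) x = ?val f (\<lambda>i. x i - ?val (a q) x * x0 i)"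
      for f x
    proof -
      have "?val (\<lambda>i. f i - ?val f x0 * a q i) x = ?val f x - ?val f x0 * ?val (a q) x"
        by (simp add: left_diff_distrib sum_subtractf sum_distrib_left mult.assoc)
      moreover have "?val f (\<lambda>i. x i - ?val (a q) x * x0 i) = ?val f x - ?val (a q) x * ?val f x0"
        by (simp add: right_diff_distrib sum_subtractf sum_distrib_left mult.left_commute)
      ultimately show ?thesis by simp
    qed
    have "?val c' x \<le> 0" if "\<And>p. p \<in> P \<Longrightarrow> ?val (a' p) x \<le> 0" for x
    proof -
      let ?x = "\<lambda>i. x i - ?val (a q) x * x0 i"
      have "?val (a p) ?x \<le> 0" if "p \<in> P" for p
        using \<open>\<And>p. p \<in> P \<Longrightarrow> ?val (a' p) x \<le> 0\<close>[OF that] project[of "a p" x]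
        by (simp add: a'_def)
      moreover have "?val (a q) ?x = 0"
        using project[of "a q" x] x0(3) by simp
      ultimately have "?val c ?x \<le> 0"
        by (intro insert.prems) auto
      then show ?thesis
        using project[of c x] by (simp add: c'_def)
    qed
    from insert.IH[OF this] obtain l
      where l: "\<forall>p\<in>P. 0 \<le> l p" "\<forall>i\<in>I. c' i = (\<Sum>p\<in>P. l p * a' p i)" by blast
    define m where "m = ?val c x0 - (\<Sum>p\<in>P. l p * ?val (a p) x0)"
    have "(\<Sum>p\<in>P. l p * ?val (a p) x0) \<le> 0"
      using l(1) x0(1) by (intro sum_nonpos) (simp add: mult_nonneg_nonpos)
    then have m: "m \<ge> 0"
      using x0(2) by (simp add: m_def)
    have coeff: "c i = m * a q i + (\<Sum>p\<in>P. l p * a p i)" if "i \<in> I" for i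
    proof -
      have "c i - ?val c x0 * a q i = (\<Sum>p\<in>P. l p * (a p i - ?val (a p) x0 * a q i))"
        using l(2) that by (simp add: c'_def a'_def)
      also have "\<dots> = (\<Sum>p\<in>P. l p * a p i) - (\<Sum>p\<in>P. l p * ?val (a p) x0) * a q i"
        by (simp add: right_diff_distrib sum_subtractf sum_distrib_right mult.assoc)
      finally show ?thesis
        by (simp add: m_def algebra_simps)
    qed
    have "(\<Sum>p\<in>P. (l(q := m)) p * a p i) = (\<Sum>p\<in>P. l p * a p i)" for i
      using insert.hyps by (intro sum.cong) auto
    then show ?thesis
      using coeff l(1) m insert.hyps by (intro exI[of _ "l(q := m)"]) auto
  qed
qed

lemma finite_items [simp]: "finite (items X)"
  by (simp add: items_def)

lemma finite_patterns [simp]: "finite (patterns X)"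
  by (rule finite_subset[of _ "Pow (items X)"]) (auto simp: patterns_def)

lemma admissible_subset_patterns: "admissible X F nd \<subseteq> patterns X"
  by (auto simp: admissible_def)

text \<open>The optimality of \<open>y\<close> says that the homogenised dual constraints (each column weighs at most
  \<open>t\<close>, and \<open>t \<ge> 0\<close>) imply that the total weight is at most \<open>t\<close> times the dual optimum.  For
  \<open>t > 0\<close> this is scaling; for \<open>t = 0\<close> it holds because the vector can be added to \<open>y\<close>.  The
  multipliers that the Farkas lemma gives for this implication are a primal feasible point of
  value at most the dual optimum.\<close>

lemma strong_duality:
  assumes C: "C \<subseteq> patterns X" and opt: "lp_optimal X C l" and y: "dual_optimal X C y"
  shows "sum l C \<le> sum y (items X)"
proof -
  let ?w = "sum y (items X)"
  have fin: "finite C"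
    using C finite_patterns finite_subset by blast
  have sub: "p \<subseteq> items X" if "p \<in> C" for p
    using C that by (auto simp: patterns_def)
  have split: "(\<Sum>i\<in>insert 0 (items X). f i) = f 0 + (\<Sum>i\<in>items X. f i)" for f :: "nat \<Rightarrow> real"
    by (simp add: items_def)
  have pos: "i \<noteq> 0" if "i \<in> items X" for i
    using that by (simp add: items_def)
  \<comment> \<open>Items are numbered from 1, so index 0 is free for the homogenising variable;
      \<open>None\<close> is its sign constraint.\<close>
  define a where "a = (\<lambda>(p :: nat set option) i. case p of None \<Rightarrow> if i = 0 then -1 else (0::real)
      | Some p \<Rightarrow> if i = 0 then -1 else of_bool (i \<in> p))"
  define c where "c = (\<lambda>i::nat. if i = 0 then - ?w else 1)"
  have val_Some: "(\<Sum>i\<in>insert 0 (items X). a (Some p) i * x i) = (\<Sum>i\<in>p. x i) - x 0"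
    if "p \<in> C" for p x
  proof -
    have "(\<Sum>i\<in>items X. a (Some p) i * x i) = (\<Sum>i\<in>items X. if i \<in> p then x i else 0)"
      by (intro sum.cong) (auto simp: a_def dest: pos)
    also have "\<dots> = (\<Sum>i\<in>items X \<inter> p. x i)"
      by (simp add: sum.inter_restrict)
    finally show ?thesis
      using sub[OF that] by (simp add: split a_def Int_absorb1)
  qed
  have val_c: "(\<Sum>i\<in>insert 0 (items X). c i * x i) = (\<Sum>i\<in>items X. x i) - ?w * x 0" for x
  proof -
    have "(\<Sum>i\<in>items X. c i * x i) = (\<Sum>i\<in>items X. x i)"
      by (intro sum.cong) (auto simp: c_def dest: pos)
    then show ?thesis by (simp add: split c_def)
  qed
  have y_feas: "\<And>p. p \<in> C \<Longrightarrow> sum y p \<le> 1"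
    and y_max: "\<And>y'. dual_feasible C y' \<Longrightarrow> sum y' (items X) \<le> ?w"
    using y by (auto simp: dual_optimal_def dual_feasible_def)
  have valid: "(\<Sum>i\<in>insert 0 (items X). c i * x i) \<le> 0"
    if x: "\<And>p. p \<in> insert None (Some ` C) \<Longrightarrow> (\<Sum>i\<in>insert 0 (items X). a p i * x i) \<le> 0" for x
  proof -
    have "(\<Sum>i\<in>items X. a None i * x i) = 0"
      by (intro sum.neutral) (auto simp: a_def dest: pos)
    then have x0: "x 0 \<ge> 0"
      using x[of None] by (simp add: split a_def)
    have xp: "sum x p \<le> x 0" if "p \<in> C" for p
      using x[of "Some p"] val_Some[OF that, of x] that by simp
    have "sum x (items X) \<le> ?w * x 0"
    proof (cases "x 0 = 0")
      case False
      have "dual_feasible C (\<lambda>i. x i / x 0)"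
        using False x0 xp by (auto simp: dual_feasible_def sum_divide_distrib[symmetric])
      from y_max[OF this] show ?thesis
        using False x0 by (simp add: sum_divide_distrib[symmetric] field_simps)
    next
      case True
      have "dual_feasible C (\<lambda>i. y i + x i)"
        using y_feas xp True by (fastforce simp: dual_feasible_def sum.distrib)
      from y_max[OF this] show ?thesis
        using True by (simp add: sum.distrib)
    qed
    then show ?thesis by (simp add: val_c)
  qed
  have "finite (insert None (Some ` C))" "finite (insert 0 (items X))"
    using fin by auto
  from farkas[OF this valid] obtain m where
    "\<forall>p\<in>insert None (Some ` C). 0 \<le> m p"
    "\<forall>i\<in>insert 0 (items X). c i = (\<Sum>p\<in>insert None (Some ` C). m p * a p i)"
    by blast
  then have m: "\<And>p. p \<in> insert None (Some ` C) \<Longrightarrow> 0 \<le> m p"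
    and eq: "\<And>i. i \<in> insert 0 (items X)
      \<Longrightarrow> c i = (\<Sum>p\<in>insert None (Some ` C). m p * a p i)"
    by blast+
  define l' where "l' = (\<lambda>p. if p \<in> C then m (Some p) else 0)"
  have sum_C: "(\<Sum>p\<in>insert None (Some ` C). m p * a p i)
      = m None * a None i + (\<Sum>p\<in>C. l' p * a (Some p) i)" for i
    using fin by (simp add: sum.reindex l'_def)
  have "(\<Sum>p | p \<in> C \<and> i \<in> p. l' p) = 1" if "i \<in> items X" for i
  proof -
    have "(\<Sum>p\<in>C. l' p * a (Some p) i) = (\<Sum>p\<in>C. if i \<in> p then l' p else 0)"
      using pos[OF that] by (intro sum.cong) (auto simp: a_def)
    also have "\<dots> = (\<Sum>p | p \<in> C \<and> i \<in> p. l' p)"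
      using fin by (simp add: sum.inter_filter)
    finally show ?thesis
      using eq[of i] sum_C[of i] that pos[OF that] by (simp add: c_def a_def)
  qed
  then have "lp_feasible X C l'"
    using m by (auto simp: lp_feasible_def l'_def)
  then have "sum l C \<le> sum l' C"
    using opt by (simp add: lp_optimal_def)
  moreover have "(\<Sum>p\<in>C. l' p * a (Some p) 0) = - sum l' C"
    by (simp add: a_def sum_negf)
  then have "sum l' C \<le> ?w"
    using eq[of 0] sum_C[of 0] m[of None] by (simp add: c_def a_def)
  ultimately show ?thesis by simp
qed

section \<open>Packings as integer solutions of the master problem\<close>

text \<open>Translations preserve area, and the boundary of a convex set is negligible.  So the item
  areas are the measures of disjoint open subsets of the bin.\<close>

lemma packable_area:
  assumes X: "valid_instance X" and S: "S \<subseteq> items X" and packable: "packable X S"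
  shows "(\<Sum>i\<in>S. item_area X i) \<le> bin_area X"
proof -
  obtain t where t: "packs X S t"
    using packable by (auto simp: packable_def)
  have fin: "finite S"
    using S finite_items finite_subset by blast
  have poly: "polytope (shape X i)" if "i \<in> S" for i
    using X S that by (auto simp: valid_instance_def convex_polygon_def)
  have area: "measure lebesgue (interior (placed X t i)) = item_area X i" if "i \<in> S" for i
  proof -
    have "polytope (placed X t i)"
      using poly[OF that] by (simp add: placed_def polytope_translation_eq)
    then have "measure lebesgue (interior (placed X t i)) = measure lebesgue (placed X t i)"
      by (intro measure_interior negligible_convex_frontier polytope_imp_bounded
          polytope_imp_convex)
    then show ?thesis
      by (simp add: placed_def item_area_def measure_translation)
  qed
  have meas: "interior (placed X t i) \<in> lmeasurable" if "i \<in> S" for i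
    using poly[OF that]
    by (intro lmeasurable_interior) (simp add: placed_def polytope_imp_bounded bounded_translation)
  have "(\<Sum>i\<in>S. item_area X i) = (\<Sum>i\<in>S. measure lebesgue (interior (placed X t i)))"
    using area by simp
  also have "\<dots> = measure lebesgue (\<Union>i\<in>S. interior (placed X t i))"
    using t fin meas
    by (intro measure_finite_Union[symmetric])
      (force simp: packs_def disjoint_family_on_def fmeasurable_def)+
  also have "\<dots> \<le> measure lebesgue (bin X)"
  proof (rule measure_mono_fmeasurable)
    show "(\<Union>i\<in>S. interior (placed X t i)) \<subseteq> bin X"
      using t interior_subset unfolding packs_def by blast
    show "(\<Union>i\<in>S. interior (placed X t i)) \<in> sets lebesgue"
      using fin meas by (intro sets.finite_UN) auto
    show "bin X \<in> lmeasurable"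
      by (simp add: bin_def)
  qed
  also have "\<dots> = bin_area X"
    using X by (simp add: bin_def bin_area_def valid_instance_def content_Pair)
  finally show ?thesis .
qed

lemma packable_mono: "packable X S \<Longrightarrow> T \<subseteq> S \<Longrightarrow> packable X T"
  unfolding packable_def packs_def by blast

definition packing_partition :: "bpp \<Rightarrow> nat set set \<Rightarrow> bool" where
  "packing_partition X P \<longleftrightarrow> partition_on (items X) P \<and> (\<forall>S\<in>P. packable X S)"

lemma feasible_packing_imp_packing_partition:
  "feasible_packing X P pl \<Longrightarrow> packing_partition X P"
  by (auto simp: feasible_packing_def packing_partition_def packable_def)

lemma finite_partition_items: "partition_on (items X) P \<Longrightarrow> finite P"
  using finite_elements finite_items by blast

lemma packing_partition_finite: "packing_partition X P \<Longrightarrow> finite P"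
  using finite_partition_items by (auto simp: packing_partition_def)

lemma packing_partition_patterns:
  "valid_instance X \<Longrightarrow> packing_partition X P \<Longrightarrow> P \<subseteq> patterns X"
  using packable_area[of X]
  by (auto simp: packing_partition_def patterns_def partition_on_def)

text \<open>A cut inside a packable block would itself be packable.\<close>

lemma packing_partition_no_cut:
  assumes "packing_partition X P" and "\<forall>S\<in>F. \<not> packable X S" and "p \<in> P"
  shows "\<not> contains_cut F p"
  using assms packable_mono unfolding packing_partition_def contains_cut_def by blast

lemma partition_on_members:
  assumes "partition_on A P" and "i \<in> A"
  obtains p where "{q \<in> P. i \<in> q} = {p}"
proof -
  obtain p where p: "p \<in> P" "i \<in> p"
    using assms by (auto simp: partition_on_def)
  then have "{q \<in> P. i \<in> q} = {p}"
    using assms by (auto simp: partition_on_def disjoint_def)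
  then show thesis by (rule that)
qed

lemma sum_indicator_filter:
  assumes "finite C" and "P \<subseteq> C"
  shows "(\<Sum>p | p \<in> C \<and> Q p. of_bool (p \<in> P) :: real) = card {p \<in> P. Q p}"
proof -
  have "(\<Sum>p | p \<in> C \<and> Q p. of_bool (p \<in> P) :: real) = card ({p. p \<in> C \<and> Q p} \<inter> P)"
    using assms by (simp add: sum_of_bool_eq)
  also have "{p. p \<in> C \<and> Q p} \<inter> P = {p \<in> P. Q p}"
    using assms by auto
  finally show ?thesis .
qed

lemma sum_indicator_cover:
  assumes "finite C" and "P \<subseteq> C" and "partition_on (items X) P" and "i \<in> items X"
  shows "(\<Sum>p | p \<in> C \<and> i \<in> p. of_bool (p \<in> P) :: real) = 1"
proof -
  obtain p where "{q \<in> P. i \<in> q} = {p}"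
    using partition_on_members assms(3,4) .
  then show ?thesis
    using sum_indicator_filter[OF assms(1,2), of "\<lambda>p. i \<in> p"] by simp
qed

lemma lp_feasible_indicator:
  assumes "C \<subseteq> patterns X" and "packing_partition X P" and "P \<subseteq> C"
  shows "lp_feasible X C (\<lambda>p. of_bool (p \<in> P))"
proof -
  have "finite C"
    using assms(1) finite_patterns finite_subset by blast
  then show ?thesis
    using assms sum_indicator_cover[of C P X]
    by (auto simp: lp_feasible_def packing_partition_def)
qed

lemma rbmp_feasible_indicator:
  assumes "valid_instance X" and P: "packing_partition X P" and F: "\<forall>S\<in>F. \<not> packable X S"
  shows "rbmp_feasible X F (\<lambda>p. of_bool (p \<in> P))"
proof -
  have sub: "P \<subseteq> patterns X"
    using assms packing_partition_patterns by blast
  have "(\<Sum>p | p \<in> patterns X \<and> S \<subseteq> p. of_bool (p \<in> P) :: real) = 0" if "S \<in> F" for S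
    using packing_partition_no_cut[OF P F] that
    by (intro sum.neutral) (auto simp: contains_cut_def)
  then show ?thesis
    using sub P sum_indicator_cover[OF _ sub, of X]
    unfolding rbmp_feasible_def packing_partition_def by auto
qed

lemma objective_indicator:
  assumes "P \<subseteq> patterns X"
  shows "objective X (\<lambda>p. of_bool (p \<in> P)) = card P"
  using sum_indicator_filter[OF _ assms, of "\<lambda>_. True"] by (simp add: objective_def)

text \<open>Weak duality for the indicator of a packing: each item lies in exactly one block, so the
  dual values add up block by block.\<close>

lemma dual_bound_packing:
  assumes "packing_partition X P" and "\<And>p. p \<in> P \<Longrightarrow> sum y p \<le> b"
  shows "sum y (items X) \<le> real (card P) * b"
proof -
  have "finite P"
    using assms packing_partition_finite by blast
  have part: "partition_on (items X) P"
    using assms by (simp add: packing_partition_def)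
  have "sum y (\<Union> P) = (\<Sum>p\<in>P. sum y p)"
    using part finite_subset[OF _ finite_items[of X]]
    by (subst sum.Union_disjoint) (auto simp: partition_on_def disjoint_def)
  then have "sum y (items X) = (\<Sum>p\<in>P. sum y p)"
    using part by (simp add: partition_on_def)
  also have "\<dots> \<le> real (card P) * b"
    using assms sum_bounded_above by metis
  finally show ?thesis .
qed

text \<open>Columns in \<open>C\<close> satisfy the dual constraint by feasibility of \<open>y\<close>, and all other admissible
  columns because pricing found no negative reduced cost.\<close>

lemma relaxation_bound:
  assumes "C \<subseteq> patterns X" and solved: "relaxation_solved X F nd C l z"
    and P: "packing_partition X P" and adm: "P \<subseteq> admissible X F nd"
  shows "z \<le> card P"
proof -
  obtain y where y: "rmp_solution X C l z y"
    and price: "admissible X F nd - C = {} \<or> (\<exists>p c. priced X F nd C y p c \<and> c \<ge> 0)"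
    using solved by (auto simp: relaxation_solved_def)
  have "z \<le> sum y (items X)"
    using y strong_duality[OF assms(1)] by (auto simp: rmp_solution_def)
  also have "\<dots> \<le> real (card P) * 1"
  proof (rule dual_bound_packing[OF P])
    fix q assume q: "q \<in> P"
    show "sum y q \<le> 1"
    proof (cases "q \<in> C")
      case True
      then show ?thesis
        using y by (auto simp: rmp_solution_def dual_optimal_def dual_feasible_def)
    next
      case False
      then have "q \<in> admissible X F nd - C"
        using q adm by auto
      then obtain p c where "priced X F nd C y p c" "c \<ge> 0" "c \<le> reduced_cost y q"
        using price by (auto simp: priced_def)
      then show ?thesis by (simp add: reduced_cost_def)
    qed
  qed
  finally show ?thesis by simp
qed

text \<open>Farley's bound in multiplied-out form: even before column generation has finished, no
  admissible column has dual weight above \<open>1 - c\<close>.\<close>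

lemma pricing_bound:
  assumes "C \<subseteq> patterns X" and y: "rmp_solution X C l z y"
    and price: "priced X F nd C y p c" and "c < 0"
    and P: "packing_partition X P" and adm: "P \<subseteq> admissible X F nd"
  shows "z \<le> real (card P) * (1 - c)"
proof -
  have "z \<le> sum y (items X)"
    using y strong_duality[OF assms(1)] by (auto simp: rmp_solution_def)
  also have "\<dots> \<le> real (card P) * (1 - c)"
  proof (rule dual_bound_packing[OF P])
    fix q assume q: "q \<in> P"
    show "sum y q \<le> 1 - c"
    proof (cases "q \<in> C")
      case True
      then have "sum y q \<le> 1"
        using y by (auto simp: rmp_solution_def dual_optimal_def dual_feasible_def)
      then show ?thesis using \<open>c < 0\<close> by simp
    next
      case False
      then have "c \<le> reduced_cost y q"
        using price q adm by (auto simp: priced_def)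
      then show ?thesis by (simp add: reduced_cost_def)
    qed
  qed
  finally show ?thesis .
qed

text \<open>Integral weights whose covering sums are 1 cover each item exactly once.  Optimality
  excludes an empty block.\<close>

lemma selected_partition:
  assumes C: "C \<subseteq> patterns X" and opt: "lp_optimal X C l" and int: "integral_weights C l"
  shows "partition_on (items X) (selected l)" and "sum l C = card (selected l)"
proof -
  have fin: "finite C"
    using C finite_patterns finite_subset by blast
  have feas: "lp_feasible X C l"
    using opt by (simp add: lp_optimal_def)
  have sel: "selected l \<subseteq> C"
    using feas by (force simp: lp_feasible_def selected_def)
  have ind: "l = (\<lambda>p. of_bool (p \<in> selected l))"
    using feas int by (force simp: lp_feasible_def selected_def integral_weights_def)
  have cover: "card {p \<in> selected l. i \<in> p} = 1" if "i \<in> items X" for i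
  proof -
    have "(\<Sum>p | p \<in> C \<and> i \<in> p. l p) = 1"
      using feas that by (simp add: lp_feasible_def)
    then show ?thesis
      using sum_indicator_filter[OF fin sel, of "\<lambda>p. i \<in> p"] by (subst (asm) ind) simp
  qed
  show "sum l C = card (selected l)"
    using sum_indicator_filter[OF fin sel, of "\<lambda>_. True"] by (subst ind) simp
  \<comment> \<open>The empty set is a pattern; dropping it would improve the objective.\<close>
  have nonempty: "{} \<notin> selected l"
  proof
    assume empty: "{} \<in> selected l"
    have "lp_feasible X C (l({} := 0))"
      unfolding lp_feasible_def
    proof (intro conjI ballI allI impI)
      fix i assume "i \<in> items X"
      have "(\<Sum>p | p \<in> C \<and> i \<in> p. (l({} := 0)) p) = (\<Sum>p | p \<in> C \<and> i \<in> p. l p)"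
        by (intro sum.cong) auto
      then show "(\<Sum>p | p \<in> C \<and> i \<in> p. (l({} := 0)) p) = 1"
        using feas \<open>i \<in> items X\<close> by (simp add: lp_feasible_def)
    qed (use feas in \<open>auto simp: lp_feasible_def\<close>)
    then have "sum l C \<le> sum (l({} := 0)) C"
      using opt unfolding lp_optimal_def by blast
    moreover have "sum (l({} := 0)) C < sum l C"
      using fin sel empty feas
      by (intro sum_strict_mono_ex1) (auto simp: selected_def lp_feasible_def)
    ultimately show False by simp
  qed
  have sub: "p \<subseteq> items X" if "p \<in> selected l" for p
    using C sel that by (auto simp: patterns_def)
  show "partition_on (items X) (selected l)"
  proof (rule partition_onI)
    show "\<Union> (selected l) = items X"
    proof (intro equalityI subsetI)
      fix i assume "i \<in> items X"
      then have "{p \<in> selected l. i \<in> p} \<noteq> {}"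
        using cover[of i] by (metis card.empty zero_neq_one)
      then show "i \<in> \<Union> (selected l)" by blast
    qed (use sub in blast)
    fix p q assume that: "p \<in> selected l" "q \<in> selected l" "p \<noteq> q"
    show "disjnt p q"
    proof (rule ccontr)
      assume "\<not> disjnt p q"
      then obtain i where i: "i \<in> p" "i \<in> q" by (auto simp: disjnt_def)
      then have "i \<in> items X" using sub that by auto
      from cover[OF this] obtain r where "{p \<in> selected l. i \<in> p} = {r}"
        by (rule card_1_singletonE)
      moreover have "p \<in> {p \<in> selected l. i \<in> p}" "q \<in> {p \<in> selected l. i \<in> p}"
        using that i by auto
      ultimately show False using that(3) by simp
    qed
  qed (use nonempty in blast)
qed

section \<open>The invariant of the search\<close>

text \<open>The set \<open>R\<close> may be used to discard a node once all its integer solutions of value \<open>k\<close> lie in it.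
  This is harmless because every rejected solution contains an unpackable bin and hence is not
  the indicator of a packing partition.\<close>

definition search_invariant ::
    "bpp \<Rightarrow> nat set set \<Rightarrow> int \<Rightarrow> open_nodes \<Rightarrow> weights set \<Rightarrow> bool" where
  "search_invariant X F k Q R \<longleftrightarrow>
     (\<forall>S\<in>F. \<not> packable X S) \<and>
     (\<forall>nd C. (nd, C) \<in> Q \<longrightarrow> C \<subseteq> admissible X F nd) \<and>
     (\<forall>l\<in>R. \<exists>S\<in>selected l. \<not> packable X S) \<and>
     (\<forall>P. packing_partition X P \<longrightarrow> k \<le> int (card P)) \<and>
     (\<forall>P. packing_partition X P \<and> int (card P) = k \<longrightarrow>
        (\<exists>nd C. (nd, C) \<in> Q \<and> P \<subseteq> admissible X F nd))"

lemma search_invariantI: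
  assumes "\<And>S. S \<in> F \<Longrightarrow> \<not> packable X S"
    and "\<And>nd C. (nd, C) \<in> Q \<Longrightarrow> C \<subseteq> admissible X F nd"
    and "\<And>l. l \<in> R \<Longrightarrow> \<exists>S\<in>selected l. \<not> packable X S"
    and "\<And>P. packing_partition X P \<Longrightarrow> k \<le> int (card P)"
    and "\<And>P. packing_partition X P \<Longrightarrow> int (card P) = k
      \<Longrightarrow> \<exists>nd C. (nd, C) \<in> Q \<and> P \<subseteq> admissible X F nd"
  shows "search_invariant X F k Q R"
  unfolding search_invariant_def
  by (intro conjI ballI allI impI; (elim conjE)?; rule assms; assumption)

lemma search_invariantD:
  assumes "search_invariant X F k Q R"
  shows "S \<in> F \<Longrightarrow> \<not> packable X S"
    and "(nd, C) \<in> Q \<Longrightarrow> C \<subseteq> admissible X F nd"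
    and "l \<in> R \<Longrightarrow> \<exists>S\<in>selected l. \<not> packable X S"
    and "packing_partition X P \<Longrightarrow> k \<le> int (card P)"
  using assms unfolding search_invariant_def by metis+

lemma search_invariant_coverE:
  assumes "search_invariant X F k Q R" and "packing_partition X P" and "int (card P) = k"
  obtains nd C where "(nd, C) \<in> Q" and "P \<subseteq> admissible X F nd"
  using assms unfolding search_invariant_def by metis

text \<open>The common form of column generation, branching and fathoming: the node \<open>nd\<close> may be
  exchanged for the nodes in \<open>N\<close> as soon as these retain its packing partitions.\<close>

lemma search_invariant_replace:
  assumes inv: "search_invariant X F k Q R"
    and new: "\<And>nd' C'. (nd', C') \<in> N \<Longrightarrow> C' \<subseteq> admissible X F nd'"
    and cover: "\<And>P. packing_partition X P \<Longrightarrow> int (card P) = k \<Longrightarrow> P \<subseteq> admissible X F nd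
      \<Longrightarrow> \<exists>nd' C'. (nd', C') \<in> N \<and> P \<subseteq> admissible X F nd'"
  shows "search_invariant X F k (N \<union> (Q - {(nd, C)})) R"
proof (rule search_invariantI)
  fix P assume P: "packing_partition X P" "int (card P) = k"
  obtain nd' C' where nd': "(nd', C') \<in> Q" "P \<subseteq> admissible X F nd'"
    using search_invariant_coverE[OF inv P] .
  show "\<exists>nd' C'. (nd', C') \<in> N \<union> (Q - {(nd, C)}) \<and> P \<subseteq> admissible X F nd'"
  proof (cases "(nd', C') = (nd, C)")
    case True
    then have "P \<subseteq> admissible X F nd" using nd'(2) by simp
    from cover[OF P this] show ?thesis by blast
  next
    case False
    then show ?thesis using nd' by blast
  qed
next
  fix nd' C' assume "(nd', C') \<in> N \<union> (Q - {(nd, C)})"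
  then show "C' \<subseteq> admissible X F nd'"
    using new search_invariantD(2)[OF inv] by blast
qed (rule search_invariantD[OF inv]; assumption)+

lemma search_invariant_fathom:
  assumes "search_invariant X F k Q R"
    and "\<And>P. packing_partition X P \<Longrightarrow> int (card P) = k \<Longrightarrow> \<not> P \<subseteq> admissible X F nd"
  shows "search_invariant X F k (Q - {(nd, C)}) R"
proof -
  have "search_invariant X F k ({} \<union> (Q - {(nd, C)})) R"
    by (rule search_invariant_replace[OF assms(1)]) (use assms(2) in blast)+
  then show ?thesis by simp
qed

lemma admissible_root:
  assumes "valid_instance X" and "packing_partition X P" and "\<forall>S\<in>F. \<not> packable X S"
  shows "P \<subseteq> admissible X F root"
  using packing_partition_patterns[OF assms(1,2)] packing_partition_no_cut[OF assms(2,3)]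
  by (auto simp: admissible_def root_def)

lemma admissible_together:
  "admissible X F (insert (i, j) (fst nd), snd nd) = {p \<in> admissible X F nd. i \<in> p \<longleftrightarrow> j \<in> p}"
  unfolding admissible_def fst_conv snd_conv ball_simps prod.case by blast

lemma admissible_separate:
  "admissible X F (fst nd, insert (i, j) (snd nd)) = {p \<in> admissible X F nd. \<not> (i \<in> p \<and> j \<in> p)}"
  unfolding admissible_def fst_conv snd_conv ball_simps prod.case by blast

text \<open>A block containing both items is the only block that contains either of them; without such a
  block, every block separates them.\<close>

lemma branch_cover:
  assumes P: "packing_partition X P" and adm: "P \<subseteq> admissible X F nd"
  shows "P \<subseteq> admissible X F (insert (i, j) (fst nd), snd nd)
    \<or> P \<subseteq> admissible X F (fst nd, insert (i, j) (snd nd))"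
proof (cases "\<exists>p\<in>P. i \<in> p \<and> j \<in> p")
  case True
  then obtain p where p: "p \<in> P" "i \<in> p" "j \<in> p" by blast
  have "i \<in> q \<longleftrightarrow> j \<in> q" if "q \<in> P" for q
    using P p that by (auto simp: packing_partition_def partition_on_def disjoint_def)
  then show ?thesis
    using adm unfolding admissible_together by (intro disjI1) blast
next
  case False
  then show ?thesis
    using adm by (auto simp: admissible_separate)
qed

lemma oracle_None: "exact_oracle X orc \<Longrightarrow> S \<subseteq> items X \<Longrightarrow> orc S = None \<Longrightarrow> \<not> packable X S"
  by (force simp: exact_oracle_def)

lemma oracle_Some: "exact_oracle X orc \<Longrightarrow> S \<subseteq> items X \<Longrightarrow> orc S \<noteq> None \<Longrightarrow> packs X S (the (orc S))"
  by (force simp: exact_oracle_def)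

text \<open>Each deletion is accepted only when the oracle still answers \<open>None\<close>, so this answer
  persists along the whole chain.\<close>

lemma cut_from_infeasible:
  assumes "cut_from orc S T" and "orc S = None"
  shows "T \<subseteq> S" and "orc T = None"
proof -
  have "T \<subseteq> S \<and> orc T = None" if "(delete_item orc)\<^sup>*\<^sup>* S T"
    using that assms(2) by induction (auto simp: delete_item_def)
  then show "T \<subseteq> S" and "orc T = None"
    using assms by (auto simp: cut_from_def)
qed

text \<open>New cuts shrink the admissible sets of all nodes, but they remove no block of a packing
  partition.  The nodes fathomed earlier need not be reopened, since they held no packing partition with
  \<open>k\<close> blocks under the old pool.\<close>

lemma search_invariant_reject:
  assumes inv: "search_invariant X F k Q R" and N: "\<forall>S\<in>N. \<not> packable X S"
    and l: "\<exists>S\<in>selected l. \<not> packable X S"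
  shows "search_invariant X (F \<union> N) k (discard N Q) (insert l R)"
proof (rule search_invariantI)
  fix P assume P: "packing_partition X P" "int (card P) = k"
  obtain nd C where nd: "(nd, C) \<in> Q" "P \<subseteq> admissible X F nd"
    using search_invariant_coverE[OF inv P] .
  have "P \<subseteq> admissible X (F \<union> N) nd"
    using nd(2) packing_partition_no_cut[OF P(1) N]
    by (auto simp: admissible_def contains_cut_def)
  moreover have "(nd, {p \<in> C. \<not> contains_cut N p}) \<in> discard N Q"
    using nd(1) by (force simp: discard_def)
  ultimately show "\<exists>nd C. (nd, C) \<in> discard N Q \<and> P \<subseteq> admissible X (F \<union> N) nd"
    by blast
next
  fix nd C assume "(nd, C) \<in> discard N Q"
  then obtain C' where C': "(nd, C') \<in> Q" "C = {p \<in> C'. \<not> contains_cut N p}"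
    by (auto simp: discard_def)
  from search_invariantD(2)[OF inv C'(1)] show "C \<subseteq> admissible X (F \<union> N) nd"
    using C'(2) by (auto simp: admissible_def contains_cut_def)
next
  fix S assume "S \<in> F \<union> N"
  then show "\<not> packable X S"
    using search_invariantD(1)[OF inv] N by blast
next
  fix l' assume "l' \<in> insert l R"
  then show "\<exists>S\<in>selected l'. \<not> packable X S"
    using search_invariantD(3)[OF inv, of l'] l by blast
qed (rule search_invariantD(4)[OF inv])

fun state_invariant :: "bpp \<Rightarrow> state \<Rightarrow> bool" where
  "state_invariant X (Search F k Q R) \<longleftrightarrow> search_invariant X F k Q R"
| "state_invariant X (Check F k Q R l D) \<longleftrightarrow>
     search_invariant X F k Q R \<and> D \<subseteq> selected l \<and>
     partition_on (items X) (selected l) \<and> int (card (selected l)) = k"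
| "state_invariant X (Done B pl) \<longleftrightarrow> optimal_packing X B pl"

lemma card_partition_items:
  assumes "partition_on (items X) P"
  shows "card P \<le> num X"
proof -
  have "finite P"
    using assms by (rule finite_partition_items)
  have block: "finite p" "p \<noteq> {}" if "p \<in> P" for p
    using assms that finite_subset[of p "items X"] by (auto simp: partition_on_def)
  have "card P = (\<Sum>p\<in>P. 1)"
    by simp
  also have "\<dots> \<le> (\<Sum>p\<in>P. card p)"
    using block by (intro sum_mono) (metis One_nat_def Suc_leI card_gt_0_iff)
  also have "\<dots> = card (\<Union> P)"
    using assms block
    by (intro card_Union_disjoint[symmetric])
      (auto simp: partition_on_def disjoint_def pairwise_def disjnt_def)
  also have "\<dots> = num X"
    using assms by (simp add: partition_on_def items_def)
  finally show ?thesis .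
qed

text \<open>The master problem is a relaxation of the packing problem.  Subtracting the tolerance and
  rounding up leaves a number that no packing can undercut, since the number of its bins is an
  integer.\<close>

lemma initial_state_invariant:
  assumes X: "valid_instance X" and "eps \<ge> 0" and init: "initial_state X eps s"
  shows "state_invariant X s"
proof -
  let ?F = "initial_pool X"
  obtain z C where z: "rbmp_opt_value X ?F z" and C: "C \<subseteq> admissible X ?F root"
    and s: "s = Search ?F \<lceil>z - eps\<rceil> {(root, C)} {}"
    using init by (auto simp: initial_state_def)
  have F: "\<forall>S\<in>?F. \<not> packable X S"
    by (auto simp: initial_pool_def)
  have "\<lceil>z - eps\<rceil> \<le> int (card P)" if P: "packing_partition X P" for P
  proof -
    have "z \<le> card P"
      using z rbmp_feasible_indicator[OF X P F]
        objective_indicator[OF packing_partition_patterns[OF X P]]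
      unfolding rbmp_opt_value_def by metis
    then show ?thesis
      using \<open>eps \<ge> 0\<close> by (simp add: ceiling_le_iff)
  qed
  then show ?thesis
    unfolding s state_invariant.simps
    using C F admissible_root[OF X _ F] by (intro search_invariantI) auto
qed

lemma step_preserves_invariant:
  assumes X: "valid_instance X" and orc: "exact_oracle X orc"
    and "step X orc s s'" and "state_invariant X s"
  shows "state_invariant X s'"
  using assms(3,4)
proof cases
  case (extend_columns nd C Q C' F k R)
  then show ?thesis
    using assms(4) search_invariant_replace[of X F k Q R "{(nd, C')}" nd C] by auto
next
  case (generate_column nd C Q l z y F p c k R)
  have "C \<subseteq> admissible X F nd"
    using generate_column assms(4) search_invariantD(2)[of X F k Q R nd C] by simp
  moreover have "p \<in> admissible X F nd"
    using generate_column by (auto simp: priced_def)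
  ultimately show ?thesis
    using generate_column assms(4) search_invariant_replace[of X F k Q R "{(nd, insert p C)}" nd C]
    by auto
next
  case (fathom_infeasible nd C Q F k R)
  have "\<not> P \<subseteq> admissible X F nd" if "packing_partition X P" for P
    using lp_feasible_indicator[OF admissible_subset_patterns that] fathom_infeasible by blast
  then show ?thesis
    using fathom_infeasible assms(4) search_invariant_fathom by simp
next
  case (fathom_bound nd C Q F L k R)
  have "\<not> P \<subseteq> admissible X F nd" if P: "packing_partition X P" "int (card P) = k" for P
  proof
    assume adm: "P \<subseteq> admissible X F nd"
    have "\<forall>S\<in>F. \<not> packable X S"
      using fathom_bound assms(4) by (simp add: search_invariant_def)
    then have "node_int_solution X F nd (\<lambda>p. of_bool (p \<in> P))"
      using rbmp_feasible_indicator[OF X P(1)] adm by (auto simp: node_int_solution_def)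
    then have "L \<le> card P"
      using fathom_bound objective_indicator[OF packing_partition_patterns[OF X P(1)]] by metis
    then show False
      using fathom_bound P(2) by auto
  qed
  then show ?thesis
    using fathom_bound assms(4) search_invariant_fathom by simp
next
  case (fathom_relaxation nd C Q F l z k R)
  have "C \<subseteq> patterns X"
    using fathom_relaxation assms(4) search_invariantD(2) admissible_subset_patterns
    by (metis state_invariant.simps(1) subset_trans)
  then have "\<not> P \<subseteq> admissible X F nd" if "packing_partition X P" "int (card P) = k" for P
    using relaxation_bound[of C X F nd l z P] fathom_relaxation that by auto
  then show ?thesis
    using fathom_relaxation assms(4) search_invariant_fathom by simp
next
  case (fathom_pricing nd C Q l z y F p c k R)
  have "C \<subseteq> patterns X"
    using fathom_pricing assms(4) search_invariantD(2) admissible_subset_patterns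
    by (metis state_invariant.simps(1) subset_trans)
  then have "\<not> P \<subseteq> admissible X F nd" if "packing_partition X P" "int (card P) = k" for P
    using pricing_bound[of C X l z y F nd p c P] fathom_pricing that by auto
  then show ?thesis
    using fathom_pricing assms(4) search_invariant_fathom by simp
next
  case (fathom_rejected nd C Q F k R)
  have inv: "search_invariant X F k Q R"
    using fathom_rejected assms(4) by simp
  have "\<not> P \<subseteq> admissible X F nd" if P: "packing_partition X P" "int (card P) = k" for P
  proof
    assume adm: "P \<subseteq> admissible X F nd"
    \<comment> \<open>The indicator of a packing selects only packable bins, so it is never rejected.\<close>
    let ?l = "\<lambda>p. of_bool (p \<in> P) :: real"
    have "\<forall>S\<in>F. \<not> packable X S"
      using inv by (simp add: search_invariant_def)
    then have "node_int_solution X F nd ?l"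
      using rbmp_feasible_indicator[OF X P(1)] adm by (auto simp: node_int_solution_def)
    moreover have "objective X ?l = real_of_int k"
      using objective_indicator[OF packing_partition_patterns[OF X P(1)]] P(2) by auto
    ultimately have "?l \<in> R"
      using fathom_rejected by blast
    then obtain S where "S \<in> selected ?l" "\<not> packable X S"
      using search_invariantD(3)[OF inv] by blast
    then show False
      using P(1) by (auto simp: selected_def packing_partition_def)
  qed
  then show ?thesis
    using fathom_rejected inv search_invariant_fathom by simp
next
  case (branch nd C Q F l z k i j together separate C1 C2 R)
  have "\<exists>nd' C'. (nd', C') \<in> {(together, C1), (separate, C2)} \<and> P \<subseteq> admissible X F nd'"
    if "packing_partition X P" "P \<subseteq> admissible X F nd" for P
    using branch_cover[OF that, of i j] branch by auto
  then show ?thesis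
    using branch assms(4)
      search_invariant_replace[of X F k Q R "{(together, C1), (separate, C2)}" nd C]
    by auto
next
  case (next_layer C F k R)
  have inv: "search_invariant X F k {} R"
    using next_layer assms(4) by simp
  then have F: "\<forall>S\<in>F. \<not> packable X S"
    by (simp add: search_invariant_def)
  \<comment> \<open>With no open node left, the covering clause of the invariant rules out \<open>k\<close> blocks.\<close>
  have "k + 1 \<le> int (card P)" if "packing_partition X P" for P
    using search_invariantD(4)[OF inv that] search_invariant_coverE[OF inv that] by fastforce
  then have "search_invariant X F (k + 1) {(root, C)} R"
    using next_layer search_invariantD[OF inv] admissible_root[OF X _ F]
    by (intro search_invariantI) auto
  then show ?thesis
    using next_layer by simp
next
  case (integer_solution nd C Q F l z k R)
  have "C \<subseteq> patterns X"
    using integer_solution assms(4) search_invariantD(2) admissible_subset_patterns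
    by (metis state_invariant.simps(1) subset_trans)
  moreover have "lp_optimal X C l" "z = sum l C"
    using integer_solution by (auto simp: relaxation_solved_def rmp_solution_def)
  ultimately have "partition_on (items X) (selected l)" "z = card (selected l)"
    using selected_partition[of C X l] integer_solution by auto
  then show ?thesis
    using integer_solution assms(4) by auto
next
  case (call_oracle S l D F k Q R)
  then show ?thesis
    using assms(4) by auto
next
  case (accept D l F k Q R)
  have inv: "search_invariant X F k Q R" and part: "partition_on (items X) (selected l)"
    and card: "int (card (selected l)) = k"
    using accept assms(4) by auto
  have "packs X S (the (orc S))" if "S \<in> selected l" for S
  proof (rule oracle_Some[OF orc])
    show "S \<subseteq> items X"
      using part that by (auto simp: partition_on_def)
    have "S \<notin> detected orc D" "S \<in> D"
      using accept that by auto
    then show "orc S \<noteq> None"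
      by (simp add: detected_def)
  qed
  then have "feasible_packing X (selected l) (\<lambda>S. the (orc S))"
    using part card_partition_items[OF part] by (simp add: feasible_packing_def)
  moreover have "card (selected l) \<le> card B'" if "feasible_packing X B' pl'" for B' pl'
    using search_invariantD(4)[OF inv feasible_packing_imp_packing_partition[OF that]] card
    by simp
  ultimately have "optimal_packing X (selected l) (\<lambda>S. the (orc S))"
    unfolding optimal_packing_def by blast
  then show ?thesis
    using accept by simp
next
  case (reject D l g N F k Q R)
  have inv: "search_invariant X F k Q R" and part: "partition_on (items X) (selected l)"
    and D: "D \<subseteq> selected l"
    using reject assms(4) by auto
  have bin: "S \<in> selected l" "S \<subseteq> items X" "orc S = None" if "S \<in> detected orc D" for S
    using that D part by (auto simp: detected_def partition_on_def)
  have "\<forall>T\<in>N. \<not> packable X T"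
  proof
    fix T assume "T \<in> N"
    then obtain S where S: "S \<in> detected orc D" "T = g S"
      using reject by auto
    then have "cut_from orc S T"
      using reject by simp
    from cut_from_infeasible[OF this bin(3)[OF S(1)]] have "T \<subseteq> items X" "orc T = None"
      using bin(2)[OF S(1)] by auto
    then show "\<not> packable X T"
      by (rule oracle_None[OF orc])
  qed
  moreover obtain S where S: "S \<in> detected orc D"
    using reject by auto
  have "\<exists>S\<in>selected l. \<not> packable X S"
    using bin[OF S] oracle_None[OF orc] by blast
  ultimately have "search_invariant X (F \<union> N) k (discard N Q) (insert l R)"
    by (rule search_invariant_reject[OF inv])
  then show ?thesis
    using reject by simp
qed

theorem theorem1:
  fixes X :: bpp and orc :: oracle_fun and eps :: real
    and B :: "nat set set" and pl :: "nat set \<Rightarrow> placement"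
  assumes "valid_instance X"
    and "exact_oracle X orc"
    and "eps \<ge> 0"
    and "terminates_with X orc eps B pl"
  shows "optimal_packing X B pl"
proof -
  obtain s where init: "initial_state X eps s" and run: "(step X orc)\<^sup>*\<^sup>* s (Done B pl)"
    using assms(4) by (auto simp: terminates_with_def)
  from run have "state_invariant X (Done B pl)"
  proof induction
    case base
    show ?case using initial_state_invariant assms(1,3) init .
  next
    case (step s' s'')
    then show ?case using step_preserves_invariant assms(1,2) by blast
  qed
  then show ?thesis by simp
qed

end
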